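(* Let $K\subset[0,1]^2$ be a convex body and let $(\theta_i)_{i\in\mathbb{N}}$ be a dense sequence in $[0,2\pi)$ such that $\theta_i\ne\theta_j$ for $i\neq j$ and $(\theta_1,\theta_2,\theta_3,\theta_4)=(0,\frac{\pi}{2},\pi,\frac{3\pi}{2})$. For $n,N\in\mathbb{N}$ with $n\ge 4$, let $\theta_{(1)}<\dots<\theta_{(n)}$ denote $\theta_1,\dots,\theta_n$ arranged in increasing order, and let $\hat P_{N,n}$ be a least squares estimator of $K$ with respect to the first $(N+1)^2$ Legendre moments on the space $\mathcal{P}(\theta_{(1)},\dots,\theta_{(n)})$. Then \[\delta_N(K,\hat P_{N,n})\to 0\quad\text{for } n,N\to\infty.\]
   Context: A convex body is a compact, convex subset of $\mathbb{R}^2$ with nonempty interior. For angles $0\le\theta_1<\dots<\theta_n<2\pi$ put $u_i=(\cos\theta_i,\sin\theta_i)^\top$ and assume $\{\sum_{i=1}^n\lambda_iu_i:\lambda_i\ge0\}=\mathbb{R}^2$. For $h_1,\dots,h_n\in\mathbb{R}$ let $P(h_1,\dots,h_n)=\bigcap_{i=1}^n\{x\in\mathbb{R}^2:\langle x,u_i\rangle\le h_i\}$. The vector $(h_1,\dots,h_n)$ is called consistent with respect to $(\theta_1,\dots,\theta_n)$ if $P(h_1,\dots,h_n)$ has support function value $h_i$ in direction $u_i$ for $1\le i\le n$. $\mathcal{P}(\theta_1,\dots,\theta_n)$ is the set of polygons $P(h_1,\dots,h_n)\subset[0,1]^2$ with $(h_1,\dots,h_n)$ consistent with respect to $(\theta_1,\dots,\theta_n)$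 (such polygons may have empty interior). For compact $K\subset[0,1]^2$ and $k,l\in\mathbb{N}_0$, the Legendre moments are $\lambda_{kl}(K)=\int_KL_k(x_1)L_l(x_2)\,d(x_1,x_2)$, where $L_i:[0,1]\to\mathbb{R}$, $i\in\mathbb{N}_0$, are the shifted normalized Legendre polynomials, obtained by Gram-Schmidt orthonormalization of $1,x,x^2,\dots$ in $L^2([0,1])$. A least squares estimator of $K$ with respect to the first $(N+1)^2$ Legendre moments on $\mathcal{P}(\theta_1,\dots,\theta_n)$ is any $P\in\mathcal{P}(\theta_1,\dots,\theta_n)$ minimizing $\sum_{k,l=0}^N(\lambda_{kl}(K)-\lambda_{kl}(P))^2$ over $\mathcal{P}(\theta_1,\dots,\theta_n)$. For compact convex $K,L\subset[0,1]^2$, $\delta_N(K,L)$ is the area of the symmetric difference $(K\setminus L)\cup(L\setminus K)$ (the subscript in $\delta_N$ stands for Nikodym and is unrelated to the integer $N$). *)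

theory Defs
  imports "HOL-Analysis.Analysis"
begin

definition unit_square :: "(real^2) set" where
  "unit_square = {x. \<forall>i. 0 \<le> x $ i \<and> x $ i \<le> 1}"

definition direction :: "real \<Rightarrow> real^2" where
  "direction t = vector [cos t, sin t]"

text \<open>Values are extended reals, so that the empty set (value \<open>-\<infinity>\<close>) and sets that are unbounded in
  the given direction (value \<open>\<infinity>\<close>) are never confused with sets that have a real support value.\<close>

definition support_function :: "(real^2) set \<Rightarrow> real^2 \<Rightarrow> ereal" where
  "support_function K u = (SUP x\<in>K. ereal (x \<bullet> u))"

text \<open>The angles and the support values are given as lists of equal length.\<close>

definition polygon :: "real list \<Rightarrow> real list \<Rightarrow> (real^2) set" where
  "polygon ts hs = (\<Inter>i<length ts. {x. x \<bullet> direction (ts ! i) \<le> hs ! i})"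

definition consistent :: "real list \<Rightarrow> real list \<Rightarrow> bool" where
  "consistent ts hs \<longleftrightarrow> length hs = length ts \<and>
     (\<forall>i<length ts. support_function (polygon ts hs) (direction (ts ! i)) = ereal (hs ! i))"

definition polygons :: "real list \<Rightarrow> (real^2) set set" where
  "polygons ts = {polygon ts hs | hs. consistent ts hs \<and> polygon ts hs \<subseteq> unit_square}"

definition L2_inner :: "(real \<Rightarrow> real) \<Rightarrow> (real \<Rightarrow> real) \<Rightarrow> real" where
  "L2_inner f g = (LINT x:{0..1}|lborel. f x * g x)"

text \<open>The shifted normalized Legendre polynomials: Gram-Schmidt orthonormalization of the monomials
  \<open>1, x, x^2, \<dots>\<close> with respect to \<^const>\<open>L2_inner\<close>.\<close>

fun legendre :: "nat \<Rightarrow> real \<Rightarrow> real" where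
  "legendre n =
     (let p = (\<lambda>x. x ^ n - (\<Sum>i<n. L2_inner (\<lambda>y. y ^ n) (legendre i) * legendre i x))
      in (\<lambda>x. p x / sqrt (L2_inner p p)))"

declare legendre.simps [simp del]

definition legendre_moment :: "nat \<Rightarrow> nat \<Rightarrow> (real^2) set \<Rightarrow> real" where
  "legendre_moment k l K = (LINT x:K|lborel. legendre k (x $ 1) * legendre l (x $ 2))"

definition least_squares_estimator ::
    "nat \<Rightarrow> real list \<Rightarrow> (real^2) set \<Rightarrow> (real^2) set \<Rightarrow> bool" where
  "least_squares_estimator N ts K P \<longleftrightarrow>
     is_arg_min (\<lambda>Q. \<Sum>k\<le>N. \<Sum>l\<le>N. (legendre_moment k l K - legendre_moment k l Q)\<^sup>2)
       (\<lambda>Q. Q \<in> polygons ts) P"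

definition nikodym_dist :: "(real^2) set \<Rightarrow> (real^2) set \<Rightarrow> real" where
  "nikodym_dist K L = measure lborel ((K - L) \<union> (L - K))"

end

theory Submission
  imports Defs "HOL-Computational_Algebra.Polynomial"
begin

text \<open>The polygon circumscribed about \<open>K\<close> with the given normal directions is a competitor in the
  minimization, and by density of the directions these polygons shrink to \<open>K\<close>. Hence, by Bessel's
  inequality, the moment deviation of the estimator is at most the Nikodym distance from \<open>K\<close> to the
  circumscribed polygon, uniformly in \<open>N\<close>, and every fixed moment of the estimator converges to
  that of \<open>K\<close>. By Weierstrass approximation the integrals over the estimators converge for all continuous
  integrands, and by approximation in \<open>L\<^sup>1\<close> also for the indicator of \<open>K\<close>. No compactness argument
  (Blaschke selection) is needed to pass from weak to strong convergence, because the symmetric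
  difference of \<open>K\<close> and \<open>P\<close> has area \<open>|K| + |P| - 2 |P \<inter> K|\<close>, which only involves integrals over \<open>P\<close>
  of the integrands \<open>1\<close> and the indicator of \<open>K\<close>.\<close>

section \<open>Orthonormality of the Legendre polynomials\<close>

lemma set_integrable_continuous_compact:
  fixes f :: "'a::euclidean_space \<Rightarrow> real"
  assumes "continuous_on UNIV f" "A \<in> sets borel" "A \<subseteq> S" "compact S"
  shows "set_integrable lborel A f"
  using set_integrable_subset[OF borel_integrable_compact[OF \<open>compact S\<close>, of f, folded set_integrable_def]] assms
  by (auto intro: continuous_on_subset)

lemma L2_inner_integrable:
  assumes "continuous_on UNIV f" "continuous_on UNIV g"
  shows "set_integrable lborel {0..1} (\<lambda>x::real. f x * g x :: real)"
  by (rule set_integrable_continuous_compact[of _ _ "{0..1}"]) (auto intro: continuous_intros assms)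

lemma L2_inner_commute: "L2_inner f g = L2_inner g f"
  by (simp add: L2_inner_def mult.commute)

lemma set_integral_sum_scaled:
  fixes f :: "'i \<Rightarrow> 'a \<Rightarrow> real"
  assumes "\<And>i. i \<in> I \<Longrightarrow> set_integrable M A (f i)"
  shows "(LINT x:A|M. (\<Sum>i\<in>I. c i * f i x)) = (\<Sum>i\<in>I. c i * (LINT x:A|M. f i x))"
proof -
  have "(LINT x:A|M. (\<Sum>i\<in>I. c i * f i x)) = (LINT x|M. (\<Sum>i\<in>I. c i * (indicator A x *\<^sub>R f i x)))"
    unfolding set_lebesgue_integral_def
    by (intro Bochner_Integration.integral_cong refl) (simp add: sum_distrib_left mult_ac)
  also have "\<dots> = (\<Sum>i\<in>I. c i * (LINT x:A|M. f i x))"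
    unfolding set_lebesgue_integral_def using assms
    by (subst Bochner_Integration.integral_sum) (simp_all add: set_integrable_def)
  finally show ?thesis .
qed

lemma L2_inner_sum_right:
  assumes "continuous_on UNIV f" "\<And>i. i \<in> I \<Longrightarrow> continuous_on UNIV (g i)"
  shows "L2_inner f (\<lambda>x. \<Sum>i\<in>I. c i * g i x) = (\<Sum>i\<in>I. c i * L2_inner f (g i))"
  unfolding L2_inner_def sum_distrib_left mult.left_commute[of "f _"]
  using assms by (intro set_integral_sum_scaled L2_inner_integrable)

lemma L2_inner_diff_right:
  assumes "continuous_on UNIV f" "continuous_on UNIV g" "continuous_on UNIV h"
  shows "L2_inner f (\<lambda>x. g x - h x) = L2_inner f g - L2_inner f h"
  unfolding L2_inner_def using assms
  by (simp add: right_diff_distrib set_integral_diff L2_inner_integrable)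

lemma L2_inner_divide_right: "L2_inner f (\<lambda>x. g x / c) = L2_inner f g / c"
  unfolding L2_inner_def by simp

text \<open>A continuous nonnegative integrand with integral zero vanishes on the whole interval,
  whereas a nonzero polynomial has only finitely many roots. This makes the normalizing constants of
  \<open>legendre\<close> positive.\<close>

lemma L2_inner_poly_pos:
  assumes "p \<noteq> 0"
  shows "L2_inner (poly p) (poly p) > 0"
proof (rule ccontr)
  have cont: "continuous_on {0..1} (\<lambda>x. poly p x * poly p x)"
    by (intro continuous_intros)
  have "L2_inner (poly p) (poly p) = integral {0..1} (\<lambda>x. poly p x * poly p x)"
    unfolding L2_inner_def by (intro set_borel_integral_eq_integral L2_inner_integrable continuous_intros)
  moreover assume "\<not> L2_inner (poly p) (poly p) > 0"
  ultimately have int: "((\<lambda>x. poly p x * poly p x) has_integral 0) (cbox 0 1)"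
    using integrable_continuous_real[OF cont] integral_nonneg[OF integrable_continuous_real[OF cont]]
    by (simp add: has_integral_integral)
  have "poly p x * poly p x = 0" if "x \<in> {0..1}" for x
    by (rule has_integral_0_cbox_imp_0[OF _ _ int, of x]) (use cont that in simp_all)
  then have "{0..1} \<subseteq> {x. poly p x = 0}"
    by auto
  then show False
    using finite_subset[OF _ poly_roots_finite[OF assms]] infinite_Icc[of 0 "1::real"] by simp
qed

text \<open>This is the polynomial \<open>p\<close> inside \<open>legendre\<close> before
  normalization, named so that its norm can be studied on its own.\<close>

definition gram_schmidt_residual :: "nat \<Rightarrow> real \<Rightarrow> real" where
  "gram_schmidt_residual n x = x ^ n - (\<Sum>i<n. L2_inner (\<lambda>y. y ^ n) (legendre i) * legendre i x)"

lemma legendre_eq: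
  "legendre n x =
     gram_schmidt_residual n x / sqrt (L2_inner (gram_schmidt_residual n) (gram_schmidt_residual n))"
  by (subst legendre.simps) (simp add: Let_def gram_schmidt_residual_def[abs_def])

text \<open>The subtracted terms have degree below \<open>n\<close> and cannot cancel the leading
  term of x^n. The polynomial form of the earlier \<open>legendre i\<close> is a hypothesis so that
  the lemma also serves within the induction of \<open>legendre_poly\<close>.\<close>

lemma gram_schmidt_residual_poly:
  assumes "\<And>i. i < n \<Longrightarrow> \<exists>q. degree q = i \<and> legendre i = poly q"
  obtains r where "degree r = n" "r \<noteq> 0" "gram_schmidt_residual n = poly r"
proof -
  from assms obtain q where q: "\<And>i. i < n \<Longrightarrow> degree (q i) = i \<and> legendre i = poly (q i)"
    by metis
  define s where "s = (\<Sum>i<n. smult (L2_inner (\<lambda>y. y ^ n) (legendre i)) (q i))"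
  have "coeff s n = 0" and *: "k > n \<Longrightarrow> coeff s k = 0" for k
    using q by (auto simp: s_def coeff_sum intro!: sum.neutral coeff_eq_0)
  then have "coeff (monom 1 n - s) n = 1"
    by simp
  moreover have "degree (monom 1 n - s) \<le> n"
    by (rule degree_le) (auto simp: *)
  ultimately have "degree (monom 1 n - s) = n" "monom 1 n - s \<noteq> 0"
    by (auto simp: le_antisym le_degree)
  moreover have "gram_schmidt_residual n = poly (monom 1 n - s)"
    using q by (auto simp: gram_schmidt_residual_def fun_eq_iff s_def poly_monom poly_sum)
  ultimately show ?thesis using that by blast
qed

lemma legendre_poly: "\<exists>q. degree q = n \<and> legendre n = poly q"
proof (induction n rule: less_induct)
  case (less n)
  obtain r where r: "degree r = n" "r \<noteq> 0" "gram_schmidt_residual n = poly r"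
    by (rule gram_schmidt_residual_poly[of n, OF less])
  let ?c = "sqrt (L2_inner (poly r) (poly r))"
  have "legendre n = poly (smult (1 / ?c) r)"
    by (auto simp: legendre_eq r fun_eq_iff)
  moreover have "degree (smult (1 / ?c) r) = n"
    using L2_inner_poly_pos[OF r(2)] r(1) by simp
  ultimately show ?case by blast
qed

lemma gram_schmidt_residual_norm_pos:
  "L2_inner (gram_schmidt_residual n) (gram_schmidt_residual n) > 0"
proof -
  obtain r where "r \<noteq> 0" "gram_schmidt_residual n = poly r"
    by (rule gram_schmidt_residual_poly[of n, OF legendre_poly])
  then show ?thesis
    using L2_inner_poly_pos by simp
qed

lemma continuous_on_legendre [continuous_intros]:
  assumes "continuous_on S f"
  shows "continuous_on S (\<lambda>x. legendre n (f x))"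
proof -
  obtain q where q: "legendre n = poly q"
    using legendre_poly by metis
  show ?thesis
    unfolding q by (rule continuous_on_poly[OF assms])
qed

text \<open>Solve the Gram-Schmidt step for x^n: the residual is its norm times
  \<open>legendre n\<close>. In this way Legendre moments determine the moments of
  monomials.\<close>

lemma power_eq_legendre_sum: "\<exists>c. \<forall>x. x ^ n = (\<Sum>i\<le>n. c i * legendre i x)"
proof -
  let ?c = "\<lambda>i. if i < n then L2_inner (\<lambda>y. y ^ n) (legendre i)
    else sqrt (L2_inner (gram_schmidt_residual n) (gram_schmidt_residual n))"
  show ?thesis
    using gram_schmidt_residual_norm_pos[of n]
    by (intro exI[of _ ?c])
      (simp add: lessThan_Suc_atMost[symmetric] legendre_eq[of n] gram_schmidt_residual_def[of n])
qed

lemma legendre_orthonormal: "L2_inner (legendre i) (legendre j) = of_bool (i = j)"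
proof -
  \<comment> \<open>Bounding both indices by \<open>n\<close> makes all earlier polynomials
    orthonormal among themselves in the induction hypothesis, as the projection argument
    requires.\<close>
  have "\<forall>i\<le>n. \<forall>j\<le>n. L2_inner (legendre i) (legendre j) = of_bool (i = j)" for n
  proof (induction n rule: less_induct)
    case (less n)
    let ?r = "gram_schmidt_residual n"
    have cont: "continuous_on UNIV (legendre i)" for i
      by (intro continuous_intros)
    have diag: "L2_inner (legendre n) (legendre n) = 1"
    proof -
      let ?c = "sqrt (L2_inner ?r ?r)"
      have "L2_inner (legendre n) (legendre n) = L2_inner (\<lambda>x. ?r x / ?c) (\<lambda>x. ?r x / ?c)"
        by (simp add: legendre_eq[of n, abs_def])
      also have "\<dots> = L2_inner ?r ?r / ?c / ?c"
        by (simp only: L2_inner_divide_right L2_inner_commute[of "\<lambda>x. ?r x / ?c" ?r])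
      also have "\<dots> = 1"
        using gram_schmidt_residual_norm_pos[of n] by simp
      finally show ?thesis .
    qed
    have off: "L2_inner (legendre k) (legendre n) = 0" if "k < n" for k
    proof -
      have "L2_inner (legendre k) ?r = L2_inner (legendre k) (\<lambda>x. x ^ n)
          - L2_inner (legendre k) (\<lambda>x. \<Sum>i<n. L2_inner (\<lambda>y. y ^ n) (legendre i) * legendre i x)"
        unfolding gram_schmidt_residual_def[abs_def]
        by (intro L2_inner_diff_right continuous_intros)
      also have "L2_inner (legendre k) (\<lambda>x. \<Sum>i<n. L2_inner (\<lambda>y. y ^ n) (legendre i) * legendre i x)
          = (\<Sum>i<n. L2_inner (\<lambda>y. y ^ n) (legendre i) * L2_inner (legendre k) (legendre i))"
        by (rule L2_inner_sum_right) (auto intro: cont)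
      \<comment> \<open>By orthonormality below \<open>n\<close> only the term \<open>i = k\<close>
        of the projection survives. It is the inner product of x^n with \<open>legendre k\<close>,
        so the difference vanishes.\<close>
      also have "\<dots> = (\<Sum>i<n. if i = k then L2_inner (\<lambda>y. y ^ n) (legendre i) else 0)"
      proof (intro sum.cong refl)
        fix i assume "i \<in> {..<n}"
        then have "L2_inner (legendre k) (legendre i) = of_bool (k = i)"
          using less[of "max k i"] that by simp
        then show "L2_inner (\<lambda>y. y ^ n) (legendre i) * L2_inner (legendre k) (legendre i)
          = (if i = k then L2_inner (\<lambda>y. y ^ n) (legendre i) else 0)"
          by simp
      qed
      also have "\<dots> = L2_inner (legendre k) (\<lambda>y. y ^ n)"
        using that by (simp add: L2_inner_commute)
      finally show ?thesis
        by (simp add: legendre_eq[of n, abs_def] L2_inner_divide_right)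
    qed
    show ?case
    proof (intro allI impI)
      fix i j assume "i \<le> n" "j \<le> n"
      then consider "i = n" "j = n" | "i = n" "j < n" | "i < n" "j = n" | "max i j < n"
        by fastforce
      then show "L2_inner (legendre i) (legendre j) = of_bool (i = j)"
        by cases (use diag off[of j] off[of i] L2_inner_commute[of "legendre i" "legendre j"] less[of "max i j"] in auto)
    qed
  qed
  then show ?thesis by (metis max.cobounded1 max.cobounded2)
qed

section \<open>Bessel's inequality for the Legendre moments\<close>

lemma Basis_vec2: "(Basis :: (real^2) set) = {axis 1 1, axis 2 1}"
  by (auto simp: Basis_vec_def UNIV_2)

lemma continuous_on_vec2: "continuous_on UNIV (\<lambda>(a, b). vector [a, b] :: real^2)"
proof -
  have "(\<lambda>(a, b). vector [a, b] :: real^2) = (\<lambda>p. fst p *\<^sub>R axis 1 1 + snd p *\<^sub>R axis 2 1)"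
    by (auto simp: vec_eq_iff forall_2 axis_def)
  then show ?thesis
    by (simp add: continuous_intros)
qed

lemma vec2_measurable: "(\<lambda>(a, b). vector [a, b] :: real^2) \<in> borel_measurable (lborel \<Otimes>\<^sub>M lborel)"
  unfolding lborel_prod using borel_measurable_continuous_onI[OF continuous_on_vec2] by simp

text \<open>Lebesgue measure is determined by its values on open boxes, and a box pulls back to a
  product of intervals. The identity makes Fubini's theorem available on
  \<open>real^2\<close>.\<close>

lemma lborel_vec2:
  "(lborel :: (real^2) measure) = distr (lborel \<Otimes>\<^sub>M lborel) borel (\<lambda>(a, b). vector [a, b])"
proof (rule lborel_eqI)
  fix l u :: "real^2"
  assume le: "\<And>b. b \<in> Basis \<Longrightarrow> l \<bullet> b \<le> u \<bullet> b"
  have le': "l $ 1 \<le> u $ 1" "l $ 2 \<le> u $ 2"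
    using le[of "axis 1 1"] le[of "axis 2 1"] by (simp_all add: Basis_vec2 inner_axis)
  have "(\<lambda>(a, b). vector [a, b]) -` box l u = {l $ 1<..<u $ 1} \<times> {l $ 2<..<u $ 2}"
    by (auto simp: box_def Basis_vec2 inner_axis)
  then have "emeasure (distr (lborel \<Otimes>\<^sub>M lborel) borel (\<lambda>(a, b). vector [a, b])) (box l u)
      = emeasure (lborel \<Otimes>\<^sub>M lborel) ({l $ 1<..<u $ 1} \<times> {l $ 2<..<u $ 2})"
    by (simp add: emeasure_distr vec2_measurable space_pair_measure)
  also have "\<dots> = ennreal ((u $ 1 - l $ 1) * (u $ 2 - l $ 2))"
    using le' by (subst lborel.emeasure_pair_measure_Times) (simp_all add: ennreal_mult)
  also have "(u $ 1 - l $ 1) * (u $ 2 - l $ 2) = (\<Prod>b\<in>Basis. (u - l) \<bullet> b)"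
    by (simp add: Basis_vec2 inner_axis axis_eq_axis)
  finally show "emeasure (distr (lborel \<Otimes>\<^sub>M lborel) borel (\<lambda>(a, b). vector [a, b])) (box l u)
      = ennreal (\<Prod>b\<in>Basis. (u - l) \<bullet> b)" .
qed simp

lemma unit_square_eq_cbox: "unit_square = cbox 0 1"
  by (auto simp: unit_square_def mem_box Basis_vec_def inner_axis)

lemma compact_unit_square: "compact unit_square"
  by (simp add: unit_square_eq_cbox)

lemma unit_square_borel: "unit_square \<in> sets borel"
  by (simp add: unit_square_eq_cbox)

text \<open>Fubini's theorem applies because the indicator of the square factors as well; continuity
  on a compact set gives integrability.\<close>

lemma integral_unit_square_product:
  assumes f: "continuous_on UNIV f" and g: "continuous_on UNIV g"
  shows "(LINT x:unit_square|lborel. f (x $ 1) * g (x $ 2)) =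
     (LINT a:{0..1}|lborel. f a) * (LINT b:{0..1}|lborel. g b :: real)"
proof -
  let ?F = "\<lambda>p. indicator ({0..1} \<times> {0..1}) p *\<^sub>R (f (fst p) * g (snd p))"
  have cont: "continuous_on UNIV (\<lambda>x::real^2. f (x $ 1) * g (x $ 2))"
    by (intro continuous_intros continuous_on_compose2[OF f] continuous_on_compose2[OF g]) auto
  have meas: "(\<lambda>x::real^2. indicator unit_square x *\<^sub>R (f (x $ 1) * g (x $ 2))) \<in> borel_measurable borel"
    by (intro borel_measurable_scaleR borel_measurable_indicator unit_square_borel
        borel_measurable_continuous_onI[OF cont])
  have int: "integrable (lborel \<Otimes>\<^sub>M lborel) ?F"
    unfolding lborel_prod
    by (intro borel_integrable_compact compact_Times compact_Icc continuous_intros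
        continuous_on_compose2[OF f] continuous_on_compose2[OF g]) auto
  have "(LINT x:unit_square|lborel. f (x $ 1) * g (x $ 2)) = integral\<^sup>L (lborel \<Otimes>\<^sub>M lborel) ?F"
    unfolding set_lebesgue_integral_def
    by (subst lborel_vec2, subst integral_distr[OF vec2_measurable meas])
      (auto intro!: Bochner_Integration.integral_cong simp: unit_square_def forall_2 indicator_def)
  also have "\<dots> = (LINT a|lborel. (LINT b|lborel. ?F (a, b)))"
    using lborel_pair.integral_fst'[OF int] by simp
  also have "\<dots> = (LINT a|lborel. (LINT b|lborel. (indicator {0..1} a *\<^sub>R f a) * (indicator {0..1} b *\<^sub>R g b)))"
    by (intro Bochner_Integration.integral_cong refl) (auto simp: indicator_def)
  finally show ?thesis
    by (simp add: set_lebesgue_integral_def)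
qed

text \<open>The integral of the squared error of the orthogonal projection onto the family is
  nonnegative. In its expansion the double sum collapses to the diagonal and cancels half of the
  mixed term.\<close>

lemma bessel_inequality:
  fixes e :: "'i \<Rightarrow> 'a \<Rightarrow> real"
  assumes fin: "finite I"
    and sq: "integrable M (\<lambda>x. (\<phi> x)\<^sup>2)"
    and coeff: "\<And>i. i \<in> I \<Longrightarrow> integrable M (\<lambda>x. \<phi> x * e i x)"
    and prod: "\<And>i j. i \<in> I \<Longrightarrow> j \<in> I \<Longrightarrow> integrable M (\<lambda>x. e i x * e j x)"
    and orth: "\<And>i j. i \<in> I \<Longrightarrow> j \<in> I \<Longrightarrow> (LINT x|M. e i x * e j x) = of_bool (i = j)"
  shows "(\<Sum>i\<in>I. (LINT x|M. \<phi> x * e i x)\<^sup>2) \<le> (LINT x|M. (\<phi> x)\<^sup>2)"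
proof -
  define a where "a i = (LINT x|M. \<phi> x * e i x)" for i
  have expand: "(\<phi> x - (\<Sum>i\<in>I. a i * e i x))\<^sup>2 =
      (\<phi> x)\<^sup>2 - (\<Sum>i\<in>I. 2 * a i * (\<phi> x * e i x)) + (\<Sum>i\<in>I. \<Sum>j\<in>I. a i * a j * (e i x * e j x))" for x
    by (simp add: power2_diff power2_eq_square[of "sum _ _"] sum_product sum_distrib_left mult_ac)
  have "0 \<le> (LINT x|M. (\<phi> x - (\<Sum>i\<in>I. a i * e i x))\<^sup>2)"
    by simp
  also have "\<dots> = (LINT x|M. (\<phi> x)\<^sup>2) - (\<Sum>i\<in>I. 2 * a i * a i) + (\<Sum>i\<in>I. \<Sum>j\<in>I. a i * a j * of_bool (i = j))"
    unfolding expand by (simp add: sq coeff prod orth a_def)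
  also have "\<dots> = (LINT x|M. (\<phi> x)\<^sup>2) - (\<Sum>i\<in>I. (a i)\<^sup>2)"
    by (simp add: fin power2_eq_square of_bool_def if_distrib sum_distrib_left[symmetric] mult.assoc cong: if_cong)
  finally show ?thesis by (simp add: a_def)
qed

section \<open>Products of Legendre polynomials as an orthonormal family on the square\<close>

abbreviation legendre2 :: "nat \<Rightarrow> nat \<Rightarrow> real^2 \<Rightarrow> real" where
  "legendre2 k l x \<equiv> legendre k (x $ 1) * legendre l (x $ 2)"

lemma legendre2_orthonormal:
  "(LINT x:unit_square|lborel. legendre2 k l x * legendre2 m n x) = of_bool (k = m \<and> l = n)"
proof -
  have "(LINT x:unit_square|lborel. legendre2 k l x * legendre2 m n x) =
     (LINT x:unit_square|lborel. (legendre k (x $ 1) * legendre m (x $ 1)) * (legendre l (x $ 2) * legendre n (x $ 2)))"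
    by (simp add: mult_ac)
  also have "\<dots> = L2_inner (legendre k) (legendre m) * L2_inner (legendre l) (legendre n)"
    unfolding L2_inner_def
    by (rule integral_unit_square_product[of "\<lambda>a. legendre k a * legendre m a" "\<lambda>b. legendre l b * legendre n b"])
      (intro continuous_intros)+
  finally show ?thesis
    by (simp add: legendre_orthonormal)
qed

lemma emeasure_subset_unit_square_finite:
  assumes "A \<subseteq> unit_square"
  shows "emeasure lborel A < \<infinity>"
  using assms compact_unit_square by (intro emeasure_bounded_finite) (auto dest: compact_imp_bounded bounded_subset)

text \<open>The moment differences are the coefficients of the difference of two indicators. This
  function takes values in {-1, 0, 1}, so its square is the indicator of the symmetric difference
  and its squared norm is the Nikodym distance.\<close>

lemma legendre_moment_bessel:
  assumes A: "A \<in> sets borel" "A \<subseteq> unit_square" and B: "B \<in> sets borel" "B \<subseteq> unit_square"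
  shows "(\<Sum>k\<le>N. \<Sum>l\<le>N. (legendre_moment k l A - legendre_moment k l B)\<^sup>2) \<le> nikodym_dist A B"
proof -
  define \<phi> :: "real^2 \<Rightarrow> real" where "\<phi> x = indicator A x - indicator B x" for x
  \<comment> \<open>The cutoff outside the square makes the family orthonormal for
    \<open>lborel\<close> itself. It does not affect products with \<phi>, which vanishes
    there.\<close>
  define e where "e = (\<lambda>(k, l) x. indicator unit_square x * legendre2 k l x)"
  have cont: "continuous_on UNIV (\<lambda>x. legendre2 k l x)" for k l
    by (intro continuous_intros)
  have set_int: "integrable lborel (\<lambda>x. indicator C x * legendre2 k l x)"
    if "C \<in> sets borel" "C \<subseteq> unit_square" for C k l
    using set_integrable_continuous_compact[OF cont that compact_unit_square] by (simp add: set_integrable_def)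
  have \<phi>_e: "\<phi> x * e (k, l) x = indicator A x * legendre2 k l x - indicator B x * legendre2 k l x" for k l x
    using A B by (auto simp: \<phi>_def e_def indicator_def)
  have e_e: "e (k, l) x * e (m, n) x = indicator unit_square x *\<^sub>R (legendre2 k l x * legendre2 m n x)" for k l m n x
    by (auto simp: e_def indicator_def)
  have \<phi>_sq: "(\<phi> x)\<^sup>2 = indicator ((A - B) \<union> (B - A)) x" for x
    by (auto simp: \<phi>_def indicator_def)
  have "(\<Sum>k\<le>N. \<Sum>l\<le>N. (legendre_moment k l A - legendre_moment k l B)\<^sup>2)
      = (\<Sum>i\<in>{..N} \<times> {..N}. (LINT x|lborel. \<phi> x * e i x)\<^sup>2)"
    unfolding sum.cartesian_product legendre_moment_def set_lebesgue_integral_def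
    by (intro sum.cong refl) (auto simp: \<phi>_e set_int A B)
  also have "\<dots> \<le> (LINT x|lborel. (\<phi> x)\<^sup>2)"
  proof (rule bessel_inequality)
    show "integrable lborel (\<lambda>x. (\<phi> x)\<^sup>2)"
      unfolding \<phi>_sq using A B
      by (intro integrable_real_indicator emeasure_subset_unit_square_finite) auto
    show "integrable lborel (\<lambda>x. \<phi> x * e i x)" for i
      by (cases i) (simp add: \<phi>_e set_int A B)
    show "integrable lborel (\<lambda>x. e i x * e j x)" for i j
    proof (cases i, cases j)
      fix k l m n assume ij: "i = (k, l)" "j = (m, n)"
      have "set_integrable lborel unit_square (\<lambda>x. legendre2 k l x * legendre2 m n x)"
        by (rule set_integrable_continuous_compact[OF _ unit_square_borel order_refl compact_unit_square])
          (intro continuous_intros)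
      then show ?thesis
        unfolding ij e_e set_integrable_def .
    qed
    show "(LINT x|lborel. e i x * e j x) = of_bool (i = j)" for i j
      using legendre2_orthonormal unfolding set_lebesgue_integral_def
      by (cases i, cases j) (simp add: e_e del: real_scaleR_def)
  qed simp
  also have "\<dots> = nikodym_dist A B"
    unfolding \<phi>_sq nikodym_dist_def using A B by simp
  finally show ?thesis .
qed

section \<open>Convergence of moments implies convergence in the Nikodym distance\<close>

text \<open>Evaluation at the constant polynomial \<open>[:b:]\<close> and then at \<open>a\<close>
  substitutes \<open>b\<close> for the outer variable and \<open>a\<close> for the inner
  one.\<close>

lemma poly_poly_eq_monomial_sum:
  fixes p :: "real poly poly"
  shows "poly (poly p [:b:]) a
    = (\<Sum>(j, i)\<in>Sigma {..degree p} (\<lambda>j. {..degree (coeff p j)}). coeff (coeff p j) i * (a ^ i * b ^ j))"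
proof -
  have "poly (poly p [:b:]) a = (\<Sum>j\<le>degree p. poly (coeff p j) a * b ^ j)"
    by (simp add: poly_altdef[of p] poly_sum poly_power)
  also have "\<dots> = (\<Sum>j\<le>degree p. \<Sum>i\<le>degree (coeff p j). coeff (coeff p j) i * (a ^ i * b ^ j))"
    by (intro sum.cong refl) (simp add: poly_altdef sum_distrib_left sum_distrib_right mult_ac)
  finally show ?thesis
    by (simp add: sum.Sigma)
qed

text \<open>Polynomials in two variables are represented as polynomials in the second variable whose
  coefficients are polynomials in the first.\<close>

lemma real_polynomial_function_vec2:
  fixes f :: "real^2 \<Rightarrow> real"
  assumes "real_polynomial_function f"
  shows "\<exists>p. \<forall>x. f x = poly (poly p [:x $ 2:]) (x $ 1)"
  using assms
proof induction
  case (linear f)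
  have "f x = poly (poly [:[:0, f (axis 1 1):], [:f (axis 2 1):]:] [:x $ 2:]) (x $ 1)" for x
  proof -
    have "x = x $ 1 *\<^sub>R axis 1 1 + x $ 2 *\<^sub>R axis 2 1"
      by (auto simp: vec_eq_iff forall_2 axis_def)
    then have "f x = f (x $ 1 *\<^sub>R axis 1 1 + x $ 2 *\<^sub>R axis 2 1)"
      by simp
    also have "\<dots> = x $ 1 * f (axis 1 1) + x $ 2 * f (axis 2 1)"
      by (simp add: linear_add linear_scale bounded_linear.linear[OF linear])
    finally show ?thesis by simp
  qed
  then show ?case by blast
next
  case (const c)
  have "c = poly (poly [:[:c:]:] [:x $ 2:]) (x $ 1)" for x :: "real^2"
    by simp
  then show ?case by blast
next
  case (add f g)
  then show ?case by (metis poly_add)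
next
  case (mult f g)
  then show ?case by (metis poly_mult)
qed

lemma set_integrable_subset_unit_square:
  assumes "continuous_on UNIV (f :: real^2 \<Rightarrow> real)" "A \<in> sets borel" "A \<subseteq> unit_square"
  shows "set_integrable lborel A f"
  by (rule set_integrable_continuous_compact[OF assms compact_unit_square])

text \<open>The bound is an L1 distance over \<open>S\<close> and does not depend on
  \<open>A\<close>, so one approximation serves all sets of a family simultaneously.\<close>

lemma set_integral_diff_le:
  fixes f g :: "'a \<Rightarrow> real"
  assumes "set_integrable M S f" "set_integrable M S g" "A \<in> sets M" "A \<subseteq> S"
  shows "\<bar>(LINT x:A|M. f x) - (LINT x:A|M. g x)\<bar> \<le> (LINT x:S|M. \<bar>f x - g x\<bar>)"
proof -
  have A: "set_integrable M A f" "set_integrable M A g"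
    using assms set_integrable_subset by blast+
  have "\<bar>(LINT x:A|M. f x) - (LINT x:A|M. g x)\<bar> = \<bar>LINT x:A|M. f x - g x\<bar>"
    using A by simp
  also have "\<dots> \<le> (LINT x:A|M. \<bar>f x - g x\<bar>)"
    using set_integral_norm_bound[OF set_integral_diff(1)[OF A]] by simp
  also have "\<dots> \<le> (LINT x:S|M. \<bar>f x - g x\<bar>)"
    unfolding set_lebesgue_integral_def
    using set_integrable_abs[OF set_integral_diff(1)] A assms
    by (intro integral_mono) (auto simp: set_integrable_def indicator_def)
  finally show ?thesis .
qed

text \<open>Off the closed set the distance is positive, so the cutoff is eventually 0; on the set
  it is always 1. For empty \<open>K\<close> it would be constantly 1, since \<open>infdist\<close>
  then has the default value 0.\<close>

lemma infdist_cutoff_tendsto_indicator: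
  assumes "closed K" "K \<noteq> {}"
  shows "(\<lambda>n. max 0 (1 - real n * infdist x K)) \<longlonglongrightarrow> indicator K x"
proof (cases "x \<in> K")
  case False
  then have "infdist x K > 0"
    using assms infdist_pos_not_in_closed by blast
  then obtain m where m: "1 < real m * infdist x K"
    using reals_Archimedean3 by blast
  have "max 0 (1 - real n * infdist x K) = 0" if "n \<ge> m" for n
  proof -
    have "real m * infdist x K \<le> real n * infdist x K"
      using that by (intro mult_right_mono) (auto simp: infdist_nonneg)
    with m show ?thesis by simp
  qed
  then show ?thesis
    using False by (intro tendsto_eventually eventually_sequentiallyI[of m]) simp
qed simp

section \<open>Weak convergence of sets whose Legendre moments converge\<close>

context
  fixes F :: "'i filter" and A :: "'i \<Rightarrow> (real^2) set" and K :: "(real^2) set"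
  assumes A: "\<And>i. A i \<in> sets borel" "\<And>i. A i \<subseteq> unit_square"
    and K: "closed K" "K \<subseteq> unit_square"
    and moments: "\<And>k l. ((\<lambda>i. legendre_moment k l (A i)) \<longlongrightarrow> legendre_moment k l K) F"
begin

lemma weak_limit_sum:
  fixes f :: "'j \<Rightarrow> real^2 \<Rightarrow> real"
  assumes "\<And>j. j \<in> J \<Longrightarrow> continuous_on UNIV (f j)"
    and "\<And>j. j \<in> J \<Longrightarrow> ((\<lambda>i. LINT x:A i|lborel. f j x) \<longlongrightarrow> (LINT x:K|lborel. f j x)) F"
  shows "((\<lambda>i. LINT x:A i|lborel. (\<Sum>j\<in>J. c j * f j x)) \<longlongrightarrow> (LINT x:K|lborel. (\<Sum>j\<in>J. c j * f j x))) F"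
proof -
  have eq: "(LINT x:B|lborel. (\<Sum>j\<in>J. c j * f j x)) = (\<Sum>j\<in>J. c j * (LINT x:B|lborel. f j x))"
    if "B \<in> sets borel" "B \<subseteq> unit_square" for B
    by (intro set_integral_sum_scaled set_integrable_subset_unit_square assms(1) that)
  show ?thesis
    unfolding eq[OF A] eq[OF borel_closed[OF K(1)] K(2)]
    by (intro tendsto_sum tendsto_mult tendsto_const assms(2))
qed

text \<open>Expanding both powers in Legendre polynomials turns the monomial into a finite
  combination of the products whose moments converge by assumption.\<close>

lemma weak_limit_monomial:
  "((\<lambda>i. LINT x:A i|lborel. x $ 1 ^ m * x $ 2 ^ n) \<longlongrightarrow> (LINT x:K|lborel. x $ 1 ^ m * x $ 2 ^ n)) F"
proof -
  obtain c d where "\<And>a. a ^ m = (\<Sum>k\<le>m. c k * legendre k a)" "\<And>b. b ^ n = (\<Sum>l\<le>n. d l * legendre l b)"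
    using power_eq_legendre_sum by metis
  then have eq: "a ^ m * b ^ n
      = (\<Sum>kl\<in>{..m} \<times> {..n}. c (fst kl) * d (snd kl) * (legendre (fst kl) a * legendre (snd kl) b))" for a b
    by (simp add: sum_product sum.cartesian_product case_prod_unfold mult_ac)
  show ?thesis
    unfolding eq
    by (rule weak_limit_sum) (intro continuous_intros, rule moments[unfolded legendre_moment_def])
qed

lemma weak_limit_polynomial:
  assumes "real_polynomial_function f"
  shows "((\<lambda>i. LINT x:A i|lborel. f x) \<longlongrightarrow> (LINT x:K|lborel. f x)) F"
proof -
  obtain p where "\<And>x. f x = poly (poly p [:x $ 2:]) (x $ 1)"
    using real_polynomial_function_vec2[OF assms] by blast
  then have eq: "f = (\<lambda>x. \<Sum>ji\<in>Sigma {..degree p} (\<lambda>j. {..degree (coeff p j)}).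
      coeff (coeff p (fst ji)) (snd ji) * (x $ 1 ^ snd ji * x $ 2 ^ fst ji))"
    by (simp add: fun_eq_iff poly_poly_eq_monomial_sum case_prod_unfold)
  show ?thesis
    unfolding eq by (rule weak_limit_sum) (intro continuous_intros, rule weak_limit_monomial)
qed

text \<open>Three-epsilon argument: replacing \<open>f\<close> by \<open>g\<close> changes the
  integral over every \<open>A i\<close> and over \<open>K\<close> by less than a third of
  \<epsilon>, uniformly in \<open>i\<close>.\<close>

lemma weak_limit_L1_closed:
  fixes f :: "real^2 \<Rightarrow> real"
  assumes f: "set_integrable lborel unit_square f"
    and approx: "\<And>\<epsilon>. \<epsilon> > 0 \<Longrightarrow> \<exists>g. set_integrable lborel unit_square g \<and>
      ((\<lambda>i. LINT x:A i|lborel. g x) \<longlongrightarrow> (LINT x:K|lborel. g x)) F \<and>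
      (LINT x:unit_square|lborel. \<bar>f x - g x\<bar>) < \<epsilon>"
  shows "((\<lambda>i. LINT x:A i|lborel. f x) \<longlongrightarrow> (LINT x:K|lborel. f x)) F"
proof (rule tendstoI)
  fix \<epsilon> :: real assume "\<epsilon> > 0"
  then obtain g where g: "set_integrable lborel unit_square g"
    and lim: "((\<lambda>i. LINT x:A i|lborel. g x) \<longlongrightarrow> (LINT x:K|lborel. g x)) F"
    and less: "(LINT x:unit_square|lborel. \<bar>f x - g x\<bar>) < \<epsilon> / 3"
    using approx[of "\<epsilon> / 3"] by auto
  have close: "\<bar>(LINT x:B|lborel. f x) - (LINT x:B|lborel. g x)\<bar> < \<epsilon> / 3"
    if "B \<in> sets borel" "B \<subseteq> unit_square" for B
    using set_integral_diff_le[OF f g _ that(2)] that(1) less by simp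
  have "\<forall>\<^sub>F i in F. dist (LINT x:A i|lborel. g x) (LINT x:K|lborel. g x) < \<epsilon> / 3"
    using lim \<open>\<epsilon> > 0\<close> by (intro tendstoD) auto
  then show "\<forall>\<^sub>F i in F. dist (LINT x:A i|lborel. f x) (LINT x:K|lborel. f x) < \<epsilon>"
  proof eventually_elim
    case (elim i)
    then show ?case
      using close[OF A, of i] close[OF borel_closed[OF K(1)] K(2)] unfolding dist_real_def by linarith
  qed
qed

lemma weak_limit_continuous:
  fixes f :: "real^2 \<Rightarrow> real"
  assumes f: "continuous_on UNIV f"
  shows "((\<lambda>i. LINT x:A i|lborel. f x) \<longlongrightarrow> (LINT x:K|lborel. f x)) F"
proof (rule weak_limit_L1_closed)
  show int_f: "set_integrable lborel unit_square f"
    by (rule set_integrable_subset_unit_square[OF f unit_square_borel order_refl])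
  fix \<epsilon> :: real assume "\<epsilon> > 0"
  \<comment> \<open>The square has area 1, so a uniform error is also an L1 bound. Half of
    \<epsilon> restores the strict inequality that is lost by integrating.\<close>
  then obtain g where g: "real_polynomial_function g" "\<And>x. x \<in> unit_square \<Longrightarrow> \<bar>f x - g x\<bar> < \<epsilon> / 2"
    using Stone_Weierstrass_real_polynomial_function[OF compact_unit_square, of f "\<epsilon> / 2"]
      continuous_on_subset[OF f] by auto
  have int_g: "set_integrable lborel unit_square g"
    using g(1) by (intro set_integrable_subset_unit_square unit_square_borel)
      (auto simp: real_polynomial_function_eq continuous_on_polymonial_function)
  have "(LINT x:unit_square|lborel. \<bar>f x - g x\<bar>) \<le> (LINT x:unit_square|lborel. \<epsilon> / 2)"
    using g(2)
    by (intro set_integral_mono set_integrable_abs set_integral_diff int_f int_g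
        set_integrable_subset_unit_square unit_square_borel continuous_on_const order_refl)
      (auto simp: less_imp_le)
  also have "\<dots> = \<epsilon> / 2"
    by (simp add: set_lebesgue_integral_def unit_square_eq_cbox content_cbox Basis_vec2 inner_axis axis_eq_axis)
  also have "\<dots> < \<epsilon>"
    using \<open>\<epsilon> > 0\<close> by simp
  finally show "\<exists>g. set_integrable lborel unit_square g \<and>
      ((\<lambda>i. LINT x:A i|lborel. g x) \<longlongrightarrow> (LINT x:K|lborel. g x)) F \<and>
      (LINT x:unit_square|lborel. \<bar>f x - g x\<bar>) < \<epsilon>"
    using int_g weak_limit_polynomial[OF g(1)] by blast
qed

text \<open>The continuous distance cutoffs tend to the indicator in L1 by dominated convergence;
  all values lie in [0, 1], so the indicator of the square dominates.\<close>

lemma weak_limit_indicator: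
  assumes "K \<noteq> {}"
  shows "((\<lambda>i. LINT x:A i|lborel. indicator K x) \<longlongrightarrow> (LINT x:K|lborel. indicator K x :: real)) F"
proof (rule weak_limit_L1_closed)
  show int_K: "set_integrable lborel unit_square (indicator K :: real^2 \<Rightarrow> real)"
    by (auto simp: set_integrable_def unit_square_borel borel_closed[OF K(1)]
        intro!: integrable_real_mult_indicator integrable_real_indicator emeasure_subset_unit_square_finite K)
  fix \<epsilon> :: real assume "\<epsilon> > 0"
  define g where "g n x = max 0 (1 - real n * infdist x K)" for n :: nat and x
  have cont: "continuous_on UNIV (g n)" for n
    unfolding g_def[abs_def] by (intro continuous_intros)
  have int_g: "set_integrable lborel unit_square (g n)" for n
    by (rule set_integrable_subset_unit_square[OF cont unit_square_borel order_refl])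
  have "(\<lambda>n. LINT x:unit_square|lborel. \<bar>indicator K x - g n x\<bar>) \<longlonglongrightarrow> (LINT x:unit_square|lborel. (0::real))"
    unfolding set_lebesgue_integral_def
  proof (rule integral_dominated_convergence)
    show "integrable lborel (indicator unit_square :: real^2 \<Rightarrow> real)"
      by (intro integrable_real_indicator emeasure_subset_unit_square_finite) (auto simp: unit_square_borel)
    show "AE x in lborel. (\<lambda>n. indicator unit_square x *\<^sub>R \<bar>indicator K x - g n x\<bar>)
        \<longlonglongrightarrow> indicator unit_square x *\<^sub>R (0::real)"
    proof (intro always_eventually allI tendsto_scaleR tendsto_const tendsto_rabs_zero)
      fix x
      have "(\<lambda>n. indicator K x - g n x) \<longlonglongrightarrow> indicator K x - indicator K x"
        unfolding g_def by (intro tendsto_diff tendsto_const infdist_cutoff_tendsto_indicator K assms)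
      then show "(\<lambda>n. indicator K x - g n x) \<longlonglongrightarrow> 0"
        by simp
    qed
    show "AE x in lborel. norm (indicator unit_square x *\<^sub>R \<bar>indicator K x - g n x\<bar>)
        \<le> indicator unit_square x" for n
      by (intro always_eventually) (auto simp: g_def indicator_def infdist_nonneg)
    show "(\<lambda>x. indicator unit_square x *\<^sub>R \<bar>indicator K x - g n x\<bar>) \<in> borel_measurable lborel" for n
    proof -
      note borel_measurable_continuous_onI[OF cont[of n], measurable] borel_closed[OF K(1), measurable] unit_square_borel[measurable]
      show ?thesis by measurable
    qed
  qed simp
  then have "\<forall>\<^sub>F n in sequentially. (LINT x:unit_square|lborel. \<bar>indicator K x - g n x\<bar>) < \<epsilon>"
    using \<open>\<epsilon> > 0\<close> by (intro order_tendstoD(2)) auto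
  then obtain n where "(LINT x:unit_square|lborel. \<bar>indicator K x - g n x\<bar>) < \<epsilon>"
    by (auto simp: eventually_sequentially)
  then show "\<exists>g. set_integrable lborel unit_square g \<and>
      ((\<lambda>i. LINT x:A i|lborel. g x) \<longlongrightarrow> (LINT x:K|lborel. g x)) F \<and>
      (LINT x:unit_square|lborel. \<bar>indicator K x - g x\<bar>) < \<epsilon>"
    using int_g weak_limit_continuous[OF cont] by blast
qed

lemma nikodym_dist_tendsto_0:
  assumes "K \<noteq> {}"
  shows "((\<lambda>i. nikodym_dist K (A i)) \<longlongrightarrow> 0) F"
proof -
  have eq: "nikodym_dist K B = (LINT x:K|lborel. 1) + (LINT x:B|lborel. 1) - 2 * (LINT x:B|lborel. indicator K x)"
    if B: "B \<in> sets borel" "B \<subseteq> unit_square" for B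
  proof -
    have int: "integrable lborel (indicator K :: real^2 \<Rightarrow> real)" "integrable lborel (indicator B :: real^2 \<Rightarrow> real)"
      "integrable lborel (indicator (B \<inter> K) :: real^2 \<Rightarrow> real)"
      using B K borel_closed[OF K(1)] by (auto intro!: integrable_real_indicator emeasure_subset_unit_square_finite)
    have "nikodym_dist K B = (LINT x|lborel. indicator ((K - B) \<union> (B - K)) x)"
      using B borel_closed[OF K(1)] by (simp add: nikodym_dist_def)
    also have "\<dots> = (LINT x|lborel. indicator K x + indicator B x - 2 * indicator (B \<inter> K) x)"
      by (intro Bochner_Integration.integral_cong refl) (auto simp: indicator_def)
    also have "\<dots> = (LINT x|lborel. indicator K x) + (LINT x|lborel. indicator B x) - 2 * (LINT x|lborel. indicator (B \<inter> K) x)"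
      using int by (simp only: Bochner_Integration.integral_diff Bochner_Integration.integral_add
          Bochner_Integration.integrable_add integrable_mult_right integral_mult_right_zero)
    finally show ?thesis
      by (simp add: set_lebesgue_integral_def indicator_inter_arith)
  qed
  have "((\<lambda>i. (LINT x:K|lborel. 1) + (LINT x:A i|lborel. 1) - 2 * (LINT x:A i|lborel. indicator K x)) \<longlongrightarrow>
      (LINT x:K|lborel. 1) + (LINT x:K|lborel. 1) - 2 * (LINT x:K|lborel. indicator K x :: real)) F"
    using assms by (intro tendsto_intros weak_limit_continuous weak_limit_indicator continuous_intros)
  then show ?thesis
    \<comment> \<open>Read backwards at \<open>K\<close>, the same formula identifies the limit as
      \<open>nikodym_dist K K\<close>, the area of the empty set.\<close>
    unfolding eq[OF A] eq[OF borel_closed[OF K(1)] K(2), symmetric] by (simp add: nikodym_dist_def)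
qed

end

section \<open>Circumscribed polygons\<close>

text \<open>Real-valued counterpart of \<open>support_function\<close>, meant for nonempty compact
  sets, where the supremum is finite and attained. Its values can serve as the list
  \<open>hs\<close> of a polygon.\<close>

definition support_value :: "(real^2) set \<Rightarrow> real \<Rightarrow> real" where
  "support_value K t = (SUP x\<in>K. x \<bullet> direction t)"

definition circumscribed_polygon :: "real list \<Rightarrow> (real^2) set \<Rightarrow> (real^2) set" where
  "circumscribed_polygon ts K = polygon ts (map (support_value K) ts)"

lemma circumscribed_polygon_eq:
  "circumscribed_polygon ts K = {x. \<forall>t\<in>set ts. x \<bullet> direction t \<le> support_value K t}"
  by (auto simp: circumscribed_polygon_def polygon_def all_set_conv_all_nth)

lemma support_value_attained:
  assumes "compact K" "K \<noteq> {}"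
  obtains y where "y \<in> K" "support_value K t = y \<bullet> direction t" "\<And>x. x \<in> K \<Longrightarrow> x \<bullet> direction t \<le> y \<bullet> direction t"
proof -
  obtain y where y: "y \<in> K" "\<And>x. x \<in> K \<Longrightarrow> x \<bullet> direction t \<le> y \<bullet> direction t"
    using continuous_attains_sup[OF assms, of "\<lambda>x. x \<bullet> direction t"]
      continuous_on_inner[OF continuous_on_id continuous_on_const] by blast
  then have "support_value K t = y \<bullet> direction t"
    unfolding support_value_def by (intro cSup_eq_maximum) auto
  with y that show ?thesis by blast
qed

lemma subset_circumscribed_polygon:
  assumes "compact K" "K \<noteq> {}"
  shows "K \<subseteq> circumscribed_polygon ts K"
  unfolding circumscribed_polygon_eq using support_value_attained[OF assms] by (smt (verit) mem_Collect_eq subsetI)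

lemma closed_polygon: "closed (polygon ts hs)"
  unfolding polygon_def by (intro closed_INT ballI closed_Collect_le continuous_intros)

lemma inner_direction: "x \<bullet> direction t = x $ 1 * cos t + x $ 2 * sin t"
  by (simp add: direction_def inner_vec_def sum_2)

lemma direction_3pi2: "cos (3 * pi / 2) = 0" "sin (3 * pi / 2) = -1"
  using cos_periodic_pi[of "pi / 2"] sin_periodic_pi[of "pi / 2"] by (simp_all add: field_simps)

text \<open>The four axis directions are the outer normals of the square's edges. In each of them a
  point of the polygon goes no further than some point of \<open>K\<close>, which lies in the
  square.\<close>

lemma circumscribed_polygon_subset_unit_square:
  assumes K: "compact K" "K \<noteq> {}" "K \<subseteq> unit_square" and ts: "{0, pi / 2, pi, 3 * pi / 2} \<subseteq> set ts"
  shows "circumscribed_polygon ts K \<subseteq> unit_square"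
proof
  fix x assume "x \<in> circumscribed_polygon ts K"
  then have x: "\<exists>y\<in>unit_square. x \<bullet> direction t \<le> y \<bullet> direction t" if "t \<in> {0, pi / 2, pi, 3 * pi / 2}" for t
    using that ts K(3) support_value_attained[OF K(1,2), of t] unfolding circumscribed_polygon_eq
    by (smt (verit) mem_Collect_eq subset_eq)
  show "x \<in> unit_square"
    using x[of 0] x[of "pi / 2"] x[of pi] x[of "3 * pi / 2"]
    by (auto simp: inner_direction unit_square_def forall_2 direction_3pi2)
qed

text \<open>Consistency holds because \<open>K\<close> touches each of its supporting lines at a
  point that also lies in the polygon, so every bound is attained.\<close>

lemma circumscribed_polygon_in_polygons:
  assumes K: "compact K" "K \<noteq> {}" "K \<subseteq> unit_square" and ts: "{0, pi / 2, pi, 3 * pi / 2} \<subseteq> set ts"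
  shows "circumscribed_polygon ts K \<in> polygons ts"
proof -
  have "support_function (circumscribed_polygon ts K) (direction t) = ereal (support_value K t)"
    if t: "t \<in> set ts" for t
  proof -
    obtain y where y: "y \<in> K" "support_value K t = y \<bullet> direction t"
      using support_value_attained[OF K(1,2)] by metis
    show ?thesis
      unfolding support_function_def
    proof (rule antisym)
      show "(SUP x\<in>circumscribed_polygon ts K. ereal (x \<bullet> direction t)) \<le> ereal (support_value K t)"
        using t by (intro SUP_least) (auto simp: circumscribed_polygon_eq)
      show "ereal (support_value K t) \<le> (SUP x\<in>circumscribed_polygon ts K. ereal (x \<bullet> direction t))"
        unfolding y(2) using y(1) subset_circumscribed_polygon[OF K(1,2)] by (intro SUP_upper) auto
    qed
  qed
  then have "consistent ts (map (support_value K) ts)"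
    by (simp add: consistent_def flip: circumscribed_polygon_def)
  then show ?thesis
    using circumscribed_polygon_subset_unit_square[OF assms]
    unfolding polygons_def circumscribed_polygon_def by blast
qed

section \<open>Shrinking of the circumscribed polygons along dense directions\<close>

lemma separating_direction:
  assumes "compact K" "convex K" "K \<noteq> {}" "x \<notin> K"
  obtains t \<gamma> where "t \<in> {0..<2 * pi}" "\<gamma> > 0" "\<And>y. y \<in> K \<Longrightarrow> (x - y) \<bullet> direction t \<ge> \<gamma>"
proof -
  obtain a b where ab: "a \<bullet> x < b" "\<And>y. y \<in> K \<Longrightarrow> a \<bullet> y > b"
    using separating_hyperplane_closed_point[of K x] assms compact_imp_closed by blast
  then have "a \<noteq> 0"
    using assms(3) by force
  \<comment> \<open>The functional \<open>a\<close> is larger on \<open>K\<close> than at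
    \<open>x\<close>, so the normal pointing from \<open>K\<close> towards \<open>x\<close> is the
    opposite one.\<close>
  define u where "u = - (a /\<^sub>R norm a)"
  have "norm u = 1"
    using \<open>a \<noteq> 0\<close> by (simp add: u_def)
  then have "(u $ 1)\<^sup>2 + (u $ 2)\<^sup>2 = 1"
    by (simp add: norm_vec_def L2_set_def sum_2)
  then obtain t where t: "0 \<le> t" "t < 2 * pi" "u $ 1 = cos t" "u $ 2 = sin t"
    using sincos_total_2pi by metis
  then have u: "direction t = u"
    by (simp add: direction_def vec_eq_iff forall_2)
  have "(x - y) \<bullet> direction t \<ge> (b - a \<bullet> x) / norm a" if "y \<in> K" for y
    using ab(2)[OF that] \<open>a \<noteq> 0\<close> unfolding u u_def
    by (simp add: inner_diff_right inner_commute[of _ a] divide_simps)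
  then show ?thesis
    using t ab(1) \<open>a \<noteq> 0\<close> by (intro that[of t "(b - a \<bullet> x) / norm a"]) auto
qed

lemma continuous_on_direction: "continuous_on S direction"
proof -
  have "direction = (\<lambda>t. cos t *\<^sub>R axis 1 1 + sin t *\<^sub>R axis 2 1)"
    by (auto simp: direction_def fun_eq_iff vec_eq_iff forall_2 axis_def)
  moreover have "continuous_on S (\<lambda>t. cos t *\<^sub>R axis 1 1 + sin t *\<^sub>R axis 2 1 :: real^2)"
    by (intro continuous_intros)
  ultimately show ?thesis
    by metis
qed

text \<open>Separation with a margin \<gamma> is stable: as \<open>K\<close> is bounded, a small
  change of direction alters all inner products with \<open>x - y\<close> by less than \<gamma>, and
  density supplies such a nearby direction in \<open>T\<close>.\<close>

lemma dense_directions_separate: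
  assumes K: "compact K" "convex K" "K \<noteq> {}" and x: "x \<notin> K"
    and dense: "{0..<2 * pi} \<subseteq> closure T"
  shows "\<exists>s\<in>T. support_value K s < x \<bullet> direction s"
proof -
  obtain t \<gamma> where t: "t \<in> {0..<2 * pi}" and \<gamma>: "\<gamma> > 0" "\<And>y. y \<in> K \<Longrightarrow> (x - y) \<bullet> direction t \<ge> \<gamma>"
    using separating_direction[OF K x] by blast
  obtain r where r: "\<And>y. y \<in> K \<Longrightarrow> dist x y \<le> r"
    using compact_imp_bounded[OF K(1)] bounded_any_center[of K x] by blast
  \<comment> \<open>The maximum makes positivity immediate, so that \<open>\<gamma> / R\<close> is
    an admissible tolerance for the directions.\<close>
  define R where "R = max 1 r"
  have R: "R > 0" "\<And>y. y \<in> K \<Longrightarrow> norm (x - y) \<le> R"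
    using r by (force simp: R_def dist_norm)+
  have "\<gamma> / R > 0"
    using \<gamma> R by simp
  then obtain d where d: "d > 0" "\<And>s. dist s t < d \<Longrightarrow> dist (direction s) (direction t) < \<gamma> / R"
    using continuous_on_direction[of UNIV] unfolding continuous_on_iff by fast
  obtain s where s: "s \<in> T" "dist s t < d"
    using dense t d(1) closure_approachable by blast
  obtain y where y: "y \<in> K" "support_value K s = y \<bullet> direction s"
    using support_value_attained[OF K(1,3)] by metis
  have "(x - y) \<bullet> (direction t - direction s) \<le> norm (x - y) * norm (direction t - direction s)"
    by (rule norm_cauchy_schwarz)
  also have "\<dots> \<le> R * norm (direction t - direction s)"
    using R(2)[OF y(1)] by (intro mult_right_mono) auto
  also have "\<dots> < \<gamma>"
    using d(2)[OF s(2)] R(1) by (simp add: dist_norm norm_minus_commute field_simps)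
  finally have "(x - y) \<bullet> direction s > 0"
    using \<gamma>(2)[OF y(1)] by (simp add: inner_diff_right)
  then show ?thesis
    using s(1) y(2) by (intro bexI[of _ s]) (simp_all add: inner_diff_left)
qed

lemma axis_angles_subset:
  fixes \<theta> :: "nat \<Rightarrow> real"
  assumes "\<theta> 1 = 0" "\<theta> 2 = pi / 2" "\<theta> 3 = pi" "\<theta> 4 = 3 * pi / 2" and "n \<ge> 4"
  shows "{0, pi / 2, pi, 3 * pi / 2} \<subseteq> \<theta> ` {1..n}"
proof -
  have "{0, pi / 2, pi, 3 * pi / 2} = \<theta> ` {1, 2, 3, 4}"
    unfolding image_insert image_empty assms(1-4) ..
  also have "\<dots> \<subseteq> \<theta> ` {1..n}"
    using assms(5) by (intro image_mono) auto
  finally show ?thesis .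
qed

text \<open>The polygons decrease and contain \<open>K\<close>, and by density every point outside
  \<open>K\<close> is eventually cut off. Continuity of the measure from above then applies to the
  differences with \<open>K\<close>.\<close>

lemma circumscribed_polygon_tendsto:
  fixes \<theta> :: "nat \<Rightarrow> real"
  assumes K: "compact K" "convex K" "K \<noteq> {}" "K \<subseteq> unit_square"
    and dense: "{0..<2 * pi} \<subseteq> closure (\<theta> ` {1..})"
    and axes: "\<theta> 1 = 0" "\<theta> 2 = pi / 2" "\<theta> 3 = pi" "\<theta> 4 = 3 * pi / 2"
  shows "(\<lambda>n. nikodym_dist K (circumscribed_polygon (sorted_list_of_set (\<theta> ` {1..n})) K)) \<longlonglongrightarrow> 0"
\<comment> \<open>After a shift by 4 every polygon has the axis directions among its normals, hence
  lies in the square and has finite area.\<close>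
proof (rule LIMSEQ_offset[of _ 4])
  define Q where "Q n = circumscribed_polygon (sorted_list_of_set (\<theta> ` {1..n + 4})) K" for n
  have Q_eq: "Q n = {x. \<forall>i\<in>{1..n + 4}. x \<bullet> direction (\<theta> i) \<le> support_value K (\<theta> i)}" for n
    by (simp add: Q_def circumscribed_polygon_eq)
  have "{0, pi / 2, pi, 3 * pi / 2} \<subseteq> \<theta> ` {1..n + 4}" for n
    using axes by (intro axis_angles_subset) auto
  then have Q_square: "Q n \<subseteq> unit_square" for n
    unfolding Q_def by (intro circumscribed_polygon_subset_unit_square K) simp
  have Q_borel: "Q n \<in> sets borel" for n
    by (simp add: Q_def circumscribed_polygon_def closed_polygon)
  have "(\<lambda>n. measure lborel (Q n - K)) \<longlonglongrightarrow> measure lborel (\<Inter>n. Q n - K)"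
  proof (rule Lim_measure_decseq)
    show "range (\<lambda>n. Q n - K) \<subseteq> sets lborel"
      using Q_borel compact_imp_closed[OF K(1)] by auto
    show "decseq (\<lambda>n. Q n - K)"
      by (intro decseq_SucI) (auto simp: Q_eq)
    show "emeasure lborel (Q n - K) \<noteq> \<infinity>" for n
      using emeasure_subset_unit_square_finite[of "Q n - K"] Q_square by fastforce
  qed
  moreover have "(\<Inter>n. Q n - K) = {}"
  proof safe
    fix x assume x: "x \<in> (\<Inter>n. Q n - K)"
    then obtain i where i: "i \<ge> 1" "support_value K (\<theta> i) < x \<bullet> direction (\<theta> i)"
      using dense_directions_separate[OF K(1-3) _ dense, of x] by auto
    \<comment> \<open>Since \<open>i\<close> belongs to \<open>{1..i + 4}\<close>, the polygon
      \<open>Q i\<close> already imposes the constraint that \<open>x\<close> violates.\<close>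
    have "x \<in> Q i"
      using x by blast
    then show "x \<in> {}"
      using i by (force simp: Q_eq)
  qed
  moreover have "measure lborel (Q n - K) = nikodym_dist K (Q n)" for n
  proof -
    have "(K - Q n) \<union> (Q n - K) = Q n - K"
      using subset_circumscribed_polygon[OF K(1,3)] by (auto simp: Q_def)
    then show ?thesis
      by (simp only: nikodym_dist_def)
  qed
  ultimately have "(\<lambda>n. nikodym_dist K (Q n)) \<longlonglongrightarrow> 0"
    by (simp only: measure_empty)
  then show "(\<lambda>n. nikodym_dist K (circumscribed_polygon (sorted_list_of_set (\<theta> ` {1..n + 4})) K)) \<longlonglongrightarrow> 0"
    by (simp only: Q_def)
qed

section \<open>Moment bound for the estimator and the joint limit\<close>

lemma least_squares_estimator_moment_le:
  assumes est: "least_squares_estimator N ts K P" and K: "compact K" "K \<noteq> {}" "K \<subseteq> unit_square"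
    and ts: "{0, pi / 2, pi, 3 * pi / 2} \<subseteq> set ts" and kl: "k \<le> N" "l \<le> N"
  shows "\<bar>legendre_moment k l P - legendre_moment k l K\<bar>
    \<le> sqrt (nikodym_dist K (circumscribed_polygon ts K))"
proof (rule real_le_rsqrt)
  let ?Q = "circumscribed_polygon ts K"
  let ?d = "\<lambda>P k l. (legendre_moment k l K - legendre_moment k l P)\<^sup>2"
  have "\<bar>legendre_moment k l P - legendre_moment k l K\<bar>\<^sup>2 = ?d P k l"
    by (simp add: power2_commute)
  also have "\<dots> \<le> (\<Sum>l\<le>N. ?d P k l)"
    using kl by (intro member_le_sum) auto
  also have "\<dots> \<le> (\<Sum>k\<le>N. \<Sum>l\<le>N. ?d P k l)"
    using kl by (intro member_le_sum[where f = "\<lambda>k. \<Sum>l\<le>N. ?d P k l"] sum_nonneg) auto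
  \<comment> \<open>Minimality of \<open>P\<close> against the circumscribed polygon as
    competitor.\<close>
  also have "\<dots> \<le> (\<Sum>k\<le>N. \<Sum>l\<le>N. ?d ?Q k l)"
    using est circumscribed_polygon_in_polygons[OF K ts]
    unfolding least_squares_estimator_def is_arg_min_def by (meson not_le)
  \<comment> \<open>Bessel's inequality removes the dependence on \<open>N\<close>.\<close>
  also have "\<dots> \<le> nikodym_dist K ?Q"
    using K circumscribed_polygon_subset_unit_square[OF K ts]
    by (intro legendre_moment_bessel)
      (auto simp: compact_imp_closed circumscribed_polygon_def closed_polygon)
  finally show "\<bar>legendre_moment k l P - legendre_moment k l K\<bar>\<^sup>2 \<le> nikodym_dist K ?Q" .
qed

theorem corollary6p5:
  fixes K :: "(real^2) set"
    and \<theta> :: "nat \<Rightarrow> real"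
    and Phat :: "nat \<Rightarrow> nat \<Rightarrow> (real^2) set"
  assumes "compact K" and "convex K" and "interior K \<noteq> {}" and "K \<subseteq> unit_square"
    and "\<And>i. i \<ge> 1 \<Longrightarrow> \<theta> i \<in> {0..<2*pi}"
    and "{0..<2*pi} \<subseteq> closure (\<theta> ` {1..})"
    and "\<And>i j. i \<ge> 1 \<Longrightarrow> j \<ge> 1 \<Longrightarrow> i \<noteq> j \<Longrightarrow> \<theta> i \<noteq> \<theta> j"
    and "\<theta> 1 = 0" and "\<theta> 2 = pi/2" and "\<theta> 3 = pi" and "\<theta> 4 = 3*pi/2"
    and "\<And>n N. n \<ge> 4 \<Longrightarrow> N \<ge> 1 \<Longrightarrow>
           least_squares_estimator N (sorted_list_of_set (\<theta> ` {1..n})) K (Phat N n)"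
  shows "((\<lambda>(n, N). nikodym_dist K (Phat N n)) \<longlongrightarrow> 0) (sequentially \<times>\<^sub>F sequentially)"
proof -
  let ?F = "sequentially \<times>\<^sub>F sequentially :: (nat \<times> nat) filter"
  let ?ts = "\<lambda>n. sorted_list_of_set (\<theta> ` {1..n})"
  note axes = assms(8-11) and est = assms(12)
  have K: "compact K" "K \<noteq> {}" "K \<subseteq> unit_square"
    using assms(1,3,4) by auto
  \<comment> \<open>\<open>Phat\<close> is controlled only for \<open>n \<ge> 4\<close> and
    \<open>N \<ge> 1\<close>. The default \<open>K\<close> elsewhere gives sets in the square for
    all index pairs and does not affect the limit.\<close>
  define A where "A = (\<lambda>(n, N). if n \<ge> 4 \<and> N \<ge> 1 then Phat N n else K)"
  have large: "\<forall>\<^sub>F (n, N) in ?F. n \<ge> 4 \<and> N \<ge> M" for M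
    unfolding eventually_prod_sequentially by (auto intro!: exI[of _ "max 4 M"])
  have P: "Phat N n \<in> sets borel \<and> Phat N n \<subseteq> unit_square" if "n \<ge> 4" "N \<ge> 1" for n N
    using est[OF that] closed_polygon
    by (auto simp: least_squares_estimator_def is_arg_min_def polygons_def)
  have "((\<lambda>p. nikodym_dist K (A p)) \<longlongrightarrow> 0) ?F"
  proof (rule nikodym_dist_tendsto_0)
    show "closed K"
      using K(1) by (rule compact_imp_closed)
    show "A p \<in> sets borel" "A p \<subseteq> unit_square" for p
      using P K compact_imp_closed[OF K(1)] by (auto simp: A_def split: prod.split)
    show "((\<lambda>p. legendre_moment k l (A p)) \<longlongrightarrow> legendre_moment k l K) ?F" for k l
    proof (rule LIM_zero_cancel, rule Lim_null_comparison)
      let ?b = "\<lambda>n. sqrt (nikodym_dist K (circumscribed_polygon (?ts n) K))"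
      show "\<forall>\<^sub>F p in ?F. norm (legendre_moment k l (A p) - legendre_moment k l K) \<le> ?b (fst p)"
        \<comment> \<open>For fixed \<open>k\<close> and \<open>l\<close> it is enough that
          \<open>N\<close> reaches both degrees; the bound itself depends on \<open>n\<close> alone,
          so no relation between the growth of \<open>n\<close> and \<open>N\<close> is
          required.\<close>
        using large[of "max 1 (max k l)"]
      proof eventually_elim
        case (elim p)
        then obtain n N where p: "p = (n, N)" "n \<ge> 4" "N \<ge> 1" "k \<le> N" "l \<le> N"
          by (cases p) auto
        have "{0, pi / 2, pi, 3 * pi / 2} \<subseteq> set (?ts n)"
          using axis_angles_subset[OF axes p(2)] by simp
        then show ?case
          using least_squares_estimator_moment_le[OF est[OF p(2,3)] K _ p(4,5)] p by (simp add: A_def)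
      qed
      have "?b \<longlonglongrightarrow> 0"
        using tendsto_real_sqrt[OF circumscribed_polygon_tendsto[OF K(1) assms(2) K(2,3) assms(6) axes]]
        by simp
      then show "((\<lambda>p. ?b (fst p)) \<longlongrightarrow> 0) ?F"
        by (rule filterlim_compose[OF _ filterlim_fst])
    qed
  qed (use K in auto)
  then show ?thesis
    by (rule Lim_transform_eventually) (use large[of 1] in \<open>auto simp: A_def elim!: eventually_mono\<close>)
qed

end
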